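(* Let $i,j$ be real numbers with $i,j>0$ and $i+j=1$. Let $\mathcal{D}=\{n_k\}_{k=0}^\infty$ be a $\mathcal{D}$-adic sequence with bounded ratios, and let $\psi:\mathbb{N}\to\mathbb{R}_{\geq 0}$ be a decreasing function with $\psi(q)\to 0$ as $q\to\infty$. Then \[ \lambda_1\big(W_{\mathcal{D}}(i,j,\psi)\big)=\begin{cases}0, & \text{if } \sum_{r\in\mathbb{N}}\psi(r)<\infty,\\ 1, & \text{if } \sum_{r\in\mathbb{N}}\psi(r)=\infty.\end{cases} \]
   Context: $\lambda_1$ denotes one-dimensional Lebesgue measure. A $\mathcal{D}$-adic (pseudo-absolute value) sequence is a strictly increasing sequence $\mathcal{D}=\{n_k\}_{k\ge 0}$ of positive integers with $n_0=1$ and $n_k\mid n_{k+1}$ for all $k$; it has bounded ratios if $n_{k+1}/n_k$ is bounded by a constant independent of $k$. The $\mathcal{D}$-adic pseudo-absolute value of $q\in\mathbb{N}$ is $|q|_{\mathcal{D}}=\inf\{1/n_m: n_m\mid q\}$, i.e. the reciprocal of the largest element of $\mathcal{D}$ dividing $q$. For real $y$, $\|y\|$ denotes the distance from $y$ to the nearest integer. For an approximating function $\psi:\mathbb{N}\to\mathbb{R}_{\ge0}$, $W_{\mathcal{D}}(i,j,\psi)$ is the set of $x\in[0,1)$ such that $\max\{|q|_{\mathcal{D}}^{1/i},\|qx\|^{1/j}\}\le\psi(q)$ for infinitely many $q\in\mathbb{N}$. *)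

theory Defs
  imports "HOL-Analysis.Analysis"
begin

definition D_adic_sequence :: "(nat \<Rightarrow> nat) \<Rightarrow> bool" where
  "D_adic_sequence n \<longleftrightarrow> strict_mono n \<and> n 0 = 1 \<and> (\<forall>k. n k dvd n (Suc k))"

definition bounded_ratios :: "(nat \<Rightarrow> nat) \<Rightarrow> bool" where
  "bounded_ratios n \<longleftrightarrow> (\<exists>C::real. \<forall>k. real (n (Suc k)) / real (n k) \<le> C)"

definition D_adic_abs :: "(nat \<Rightarrow> nat) \<Rightarrow> nat \<Rightarrow> real" where
  "D_adic_abs n q = Inf {1 / real (n m) | m. n m dvd q}"

definition nearest_int_dist :: "real \<Rightarrow> real" where
  "nearest_int_dist y = infdist y \<int>"

text \<open>The denominators \<open>q\<close> are positive integers; the value \<open>\<psi> 0\<close> is never used.\<close>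

definition W_D :: "(nat \<Rightarrow> nat) \<Rightarrow> real \<Rightarrow> real \<Rightarrow> (nat \<Rightarrow> real) \<Rightarrow> real set" where
  "W_D n i j \<psi> = {x \<in> {0..<1}. infinite {q. 1 \<le> q \<and>
     max (D_adic_abs n q powr (1 / i)) (nearest_int_dist (real q * x) powr (1 / j)) \<le> \<psi> q}}"

lemma W_D_measurable: "W_D n i j \<psi> \<in> sets borel"
proof -
  have [measurable]: "nearest_int_dist \<in> borel_measurable borel"
    unfolding nearest_int_dist_def
    by (intro borel_measurable_continuous_onI continuous_intros)
  have "W_D n i j \<psi> = {0..<1} \<inter> {x. \<forall>m. \<exists>q. m < q \<and> 1 \<le> q \<and>
     max (D_adic_abs n q powr (1 / i)) (nearest_int_dist (real q * x) powr (1 / j)) \<le> \<psi> q}"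
    unfolding W_D_def infinite_nat_iff_unbounded by auto
  also have "\<dots> \<in> sets borel"
    by measurable
  finally show ?thesis .
qed

end

theory Submission
  imports Defs
begin

text \<open>
  Writing \<open>\<psi>\<^sub>t = \<psi>(2\<^sup>t)\<close>, the denominators \<open>q\<close> in the block \<open>[2\<^sup>t, 2\<^sup>t\<^sup>+\<^sup>1)\<close> with
  \<open>|q|\<^sub>D \<le> \<psi>\<^sub>t\<^sup>i\<close> are the multiples of one element \<open>N\<^sub>t\<close> of the sequence, the least one that is
  at least \<open>\<psi>\<^sub>t\<^sup>-\<^sup>i\<close>. There are at most \<open>2\<^sup>t\<^sup>+\<^sup>1 \<psi>\<^sub>t\<^sup>i\<close> of them, and each contributes measure
  \<open>O(\<psi>\<^sub>t\<^sup>j)\<close>, so the convergence case follows from Cauchy condensation and Borel--Cantelli.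

  In the divergence case, bounded ratios give \<open>N\<^sub>t = O(\<psi>\<^sub>t\<^sup>-\<^sup>i)\<close>. The fractions \<open>a / (N\<^sub>t q')\<close> with
  \<open>N\<^sub>t q' \<le> 2\<^sup>t\<close> are separated by at least \<open>N\<^sub>t / 4\<^sup>t\<close>, and any fixed interval contains a
  proportional number of them once \<open>N\<^sub>t\<close> is large, because they are \<open>1 / N\<^sub>t\<close>-periodic and each
  period is a scaled copy of the Farey fractions. The separation makes the neighbourhoods of radius
  about \<open>\<psi>\<^sub>t\<^sup>j / 2\<^sup>t\<close> of these points quasi-independent on every interval, up to an error that decays
  geometrically in the distance of the blocks. A second moment argument then shows that the limsup
  set fills a fixed proportion of every interval, hence has full measure. Lower bounds on the
  denominators come for free, since \<open>N\<^sub>t\<close> divides them and tends to infinity.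
\<close>

subsection \<open>Limsup sets of full measure\<close>

text \<open>A weak substitute for the Lebesgue density theorem. The bound extends from intervals to
  bounded open sets by summing over components, each of which is an open interval. If the complement
  of \<open>E\<close> had positive measure inside a bounded window, a tight open cover of that part
  would leave \<open>E\<close> too little room.\<close>

lemma full_measure_if_positive_proportion_on_intervals:
  fixes E :: "real set"
  assumes E [measurable]: "E \<in> sets borel" and c: "c > 0"
    and dense: "\<And>a b. a < b \<Longrightarrow> c * (b - a) \<le> measure lborel (E \<inter> {a<..<b})"
  shows "- E \<in> null_sets lborel"
proof -
  have ivl: "ennreal c * emeasure lborel {a<..<b} \<le> emeasure lborel (E \<inter> {a<..<b})"
    if "a < b" for a b
  proof -
    have "E \<inter> {a<..<b} \<in> fmeasurable lborel"
      by (rule fmeasurableI2[of "{a<..<b}"]) (use that in \<open>auto simp: fmeasurable_def\<close>)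
    then have "emeasure lborel (E \<inter> {a<..<b}) = ennreal (measure lborel (E \<inter> {a<..<b}))"
      by (rule emeasure_eq_measure2)
    then show ?thesis
      using dense[OF that] that c by (simp flip: ennreal_mult)
  qed
  have opn: "ennreal c * emeasure lborel U \<le> emeasure lborel (E \<inter> U)"
    if U: "open U" "bounded U" for U
  proof -
    have cts: "countable (components U)"
      by (rule countable_disjoint_open_subsets)
         (use U open_components pairwise_disjoint_components[of U] in \<open>auto simp: pairwise_def disjnt_def\<close>)
    have disj: "disjoint_family_on (\<lambda>C. C) (components U)"
      using pairwise_disjoint_components[of U]
      by (auto simp: disjoint_family_on_def pairwise_def disjnt_def)
    have disjE: "disjoint_family_on (\<lambda>C. E \<inter> C) (components U)"
      using disj by (auto simp: disjoint_family_on_def)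
    have comp: "ennreal c * emeasure lborel C \<le> emeasure lborel (E \<inter> C)"
      if C: "C \<in> components U" for C
    proof -
      have ne: "C \<noteq> {}" and op: "open C" and con: "connected C" and "C \<subseteq> U"
        using C U by (auto simp: in_components_nonempty open_components in_components_connected
            in_components_subset)
      have bd: "bdd_above C" "bdd_below C"
        using bounded_subset[OF U(2) \<open>C \<subseteq> U\<close>]
        by (auto intro: bounded_imp_bdd_above bounded_imp_bdd_below)
      have eq: "C = {Inf C<..<Sup C}"
      proof (rule set_eqI, rule iffI)
        fix x assume x: "x \<in> C"
        then obtain e where e: "e > 0" "ball x e \<subseteq> C"
          using op openE by blast
        then have "x - e/2 \<in> C" "x + e/2 \<in> C"
          by (auto simp: subset_iff dist_real_def)
        then have "Inf C \<le> x - e/2" "x + e/2 \<le> Sup C"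
          using bd by (auto intro: cInf_lower cSup_upper)
        then show "x \<in> {Inf C<..<Sup C}" using e by auto
      next
        fix x assume x: "x \<in> {Inf C<..<Sup C}"
        obtain y z where "y \<in> C" "y < x" "z \<in> C" "x < z"
          using x ne bd by (auto simp: cInf_less_iff less_cSup_iff)
        then show "x \<in> C"
          using con connectedD_interval[of C y z x] by auto
      qed
      have "Inf C < Sup C" using ne eq by force
      then show ?thesis using ivl eq by metis
    qed
    have "ennreal c * emeasure lborel U = ennreal c * emeasure lborel (\<Union>C\<in>components U. C)"
      by (simp add: Union_components[symmetric])
    also have "\<dots> = ennreal c * (\<integral>\<^sup>+C. emeasure lborel C \<partial>count_space (components U))"
      using U by (subst emeasure_UN_countable[OF _ cts disj]) (auto simp: open_components)
    also have "\<dots> = (\<integral>\<^sup>+C. ennreal c * emeasure lborel C \<partial>count_space (components U))"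
      by (simp add: nn_integral_cmult)
    also have "\<dots> \<le> (\<integral>\<^sup>+C. emeasure lborel (E \<inter> C) \<partial>count_space (components U))"
      by (intro nn_integral_mono) (auto intro: comp)
    also have "\<dots> = emeasure lborel (\<Union>C\<in>components U. E \<inter> C)"
      using U by (subst emeasure_UN_countable[OF _ cts disjE]) (auto simp: open_components)
    also have "(\<Union>C\<in>components U. E \<inter> C) = E \<inter> U"
      using Union_components[of U] by blast
    finally show ?thesis .
  qed
  have "{- real k..real k} - E \<in> null_sets lborel" for k :: nat
  proof (rule ccontr)
    define B where "B = {- real k..real k} - E"
    assume "{- real k..real k} - E \<notin> null_sets lborel"
    then have "emeasure lborel B \<noteq> 0"
      by (auto simp: B_def null_sets_def)
    moreover have fB: "B \<in> fmeasurable lborel"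
      unfolding B_def by (rule fmeasurableI2[of "{- real k..real k}"]) (auto simp: fmeasurable_def)
    ultimately have pos: "measure lborel B > 0"
      by (simp add: emeasure_eq_measure2 zero_less_measure_iff)
    \<comment> \<open>\<open>E\<close> misses \<open>B\<close>, so its part of \<open>V\<close> lies
      in \<open>U - B\<close>. An excess of half of \<open>c * measure lborel B\<close> is therefore
      less than what \<open>opn\<close> grants to \<open>E\<close>.\<close>
    obtain U where U: "open U" "B \<subseteq> U" "emeasure lborel (U - B) \<le> ennreal (c * measure lborel B / 2)"
      using outer_regular_lborel_le[of B "c * measure lborel B / 2"] fB pos c
      by (auto simp: fmeasurable_def)
    define V where "V = U \<inter> {- real k - 1<..<real k + 1}"
    have V: "open V" "bounded V" "B \<subseteq> V"
      using U by (auto simp: V_def B_def intro: bounded_subset[of "{- real k - 1<..<real k + 1}"])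
    have "ennreal (c * measure lborel B) = ennreal c * emeasure lborel B"
      using c fB by (simp add: emeasure_eq_measure2 ennreal_mult)
    also have "\<dots> \<le> ennreal c * emeasure lborel V"
      using V by (intro mult_left_mono emeasure_mono) auto
    also have "\<dots> \<le> emeasure lborel (E \<inter> V)"
      by (rule opn[OF V(1,2)])
    also have "\<dots> \<le> emeasure lborel (U - B)"
      using U fB by (intro emeasure_mono) (auto simp: V_def B_def)
    also note U(3)
    finally show False
      using c pos by (simp add: ennreal_le_iff)
  qed
  then have "(\<Union>k. {- real k..real k} - E) \<in> null_sets lborel"
    by (intro null_sets_UN) auto
  moreover have "(\<Union>k. {- real k..real k} - E) = - E"
  proof -
    have "\<exists>k. x \<in> {- real k..real k}" for x
      using real_arch_simple[of "\<bar>x\<bar>"] by (auto simp: abs_le_iff) (metis minus_le_iff)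
    then show ?thesis by blast
  qed
  ultimately show ?thesis by simp
qed

text \<open>Cauchy-Schwarz for the counting function Y, the sum of the indicators, which vanishes
  off the union. It is obtained by integrating (Y - l)^2 \<ge> 0 over the union and taking
  \<open>l = S / m\<close>.\<close>

lemma sum_measure_squared_le:
  assumes F: "finite F" and A: "\<And>t. t \<in> F \<Longrightarrow> A t \<in> fmeasurable M"
  shows "(\<Sum>t\<in>F. measure M (A t))\<^sup>2
           \<le> measure M (\<Union>t\<in>F. A t) * (\<Sum>s\<in>F. \<Sum>t\<in>F. measure M (A s \<inter> A t))"
proof -
  define U where "U = (\<Union>t\<in>F. A t)"
  define m where "m = measure M U"
  define S where "S = (\<Sum>t\<in>F. measure M (A t))"
  define T where "T = (\<Sum>s\<in>F. \<Sum>t\<in>F. measure M (A s \<inter> A t))"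
  have U: "U \<in> fmeasurable M"
    unfolding U_def using F A by (intro fmeasurable.finite_UN) auto
  have int: "integrable M (indicator B :: _ \<Rightarrow> real)" if "B \<in> fmeasurable M" for B
    using that by (auto simp: fmeasurable_def integrable_indicator_iff)
  have AA: "A s \<inter> A t \<in> fmeasurable M" if "s \<in> F" "t \<in> F" for s t
    using A that by (intro fmeasurable.Int) auto
  have main: "2 * l * S \<le> T + l\<^sup>2 * m" for l
  proof -
    have pw: "(\<Sum>t\<in>F. 2 * l * indicator (A t) x)
        \<le> (\<Sum>s\<in>F. \<Sum>t\<in>F. indicator (A s \<inter> A t) x) + l\<^sup>2 * (indicator U x :: real)" for x
    proof (cases "x \<in> U")
      case True
      let ?Y = "\<Sum>t\<in>F. indicator (A t) x :: real"
      have "(\<Sum>s\<in>F. \<Sum>t\<in>F. indicator (A s \<inter> A t) x) = ?Y * ?Y"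
        by (simp add: sum_product indicator_inter_arith)
      moreover have "(\<Sum>t\<in>F. 2 * l * indicator (A t) x) = 2 * l * ?Y"
        by (simp add: sum_distrib_left)
      moreover have "0 \<le> (?Y - l)\<^sup>2" by simp
      ultimately show ?thesis
        using True by (simp add: power2_eq_square algebra_simps)
    next
      case False
      then have "indicator (A t) x = (0::real)" if "t \<in> F" for t
        using that by (auto simp: U_def)
      then show ?thesis
        using False by (simp add: indicator_inter_arith)
    qed
    have i1: "integrable M (\<lambda>x. \<Sum>t\<in>F. 2 * l * indicator (A t) x)"
      by (intro Bochner_Integration.integrable_sum integrable_mult_right int A)
    have i2: "integrable M (\<lambda>x. \<Sum>s\<in>F. \<Sum>t\<in>F. indicator (A s \<inter> A t) x :: real)"
      by (intro Bochner_Integration.integrable_sum int AA)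
    have i3: "integrable M (\<lambda>x. l\<^sup>2 * (indicator U x :: real))"
      by (intro integrable_mult_right int U)
    have m: "integral\<^sup>L M (indicator B) = measure M B" if "B \<in> fmeasurable M" for B
    proof -
      have "B \<inter> space M = B" using that sets.sets_into_space by blast
      then show ?thesis by simp
    qed
    have "(\<integral>x. (\<Sum>t\<in>F. 2 * l * indicator (A t) x) \<partial>M)
       \<le> (\<integral>x. (\<Sum>s\<in>F. \<Sum>t\<in>F. indicator (A s \<inter> A t) x) + l\<^sup>2 * (indicator U x :: real) \<partial>M)"
      using pw i1 i2 i3 by (intro integral_mono) auto
    also have "\<dots> = (\<integral>x. (\<Sum>s\<in>F. \<Sum>t\<in>F. indicator (A s \<inter> A t) x) \<partial>M) + l\<^sup>2 * m"
      using i2 i3 m[OF U] by (subst Bochner_Integration.integral_add) (auto simp: m_def)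
    also have "(\<integral>x. (\<Sum>s\<in>F. \<Sum>t\<in>F. indicator (A s \<inter> A t) x) \<partial>M) = T"
      unfolding T_def
      by (subst Bochner_Integration.integral_sum, force intro: int AA,
          intro sum.cong refl, subst Bochner_Integration.integral_sum)
         (auto simp: int AA m simp del: indicator_inter_arith intro!: sum.cong)
    also have "(\<integral>x. (\<Sum>t\<in>F. 2 * l * indicator (A t) x) \<partial>M) = 2 * l * S"
      unfolding S_def
      by (subst Bochner_Integration.integral_sum)
         (auto simp: int A m sum_distrib_left intro!: sum.cong)
    finally show ?thesis .
  qed
  have "S\<^sup>2 \<le> m * T"
  proof (cases "m = 0")
    case True
    have "S = 0"
    proof -
      have "measure M (A t) = 0" if "t \<in> F" for t
      proof -
        have "measure M (A t) \<le> measure M U"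
          using that A U by (intro measure_mono_fmeasurable) (auto simp: U_def fmeasurable_def)
        then show ?thesis
          using True by (intro antisym) (auto simp: m_def)
      qed
      then show ?thesis by (simp add: S_def)
    qed
    then show ?thesis using True by simp
  next
    case False
    then have "m > 0" by (simp add: m_def zero_less_measure_iff)
    with main[of "S / m"] show ?thesis
      by (simp add: field_simps power2_eq_square)
  qed
  then show ?thesis by (simp add: S_def T_def m_def U_def)
qed

text \<open>Divergence half of Borel-Cantelli under quasi-independence: the second moment inequality
  on a block of indices with large total \<open>v\<close> bounds every tail union from below, and
  continuity from above passes to the limsup.\<close>

lemma limsup_measure_ge:
  fixes v :: "nat \<Rightarrow> real"
  assumes I: "I \<in> fmeasurable M"
    and A: "\<And>t. A t \<in> sets M" "\<And>t. A t \<subseteq> I"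
    and v: "\<And>t. 0 \<le> v t" "\<not> summable v"
    and a: "0 < a" and L: "0 < L"
    and lower: "\<And>t. t0 \<le> t \<Longrightarrow> a * L * v t \<le> measure M (A t)"
    and upper: "\<And>s t. t0 \<le> s \<Longrightarrow> s \<le> t \<Longrightarrow>
           measure M (A s \<inter> A t) \<le> L * (v s * v t + (1/2) ^ (t - s) * v s)"
  shows "a\<^sup>2 / 2 * L \<le> measure M (limsup A)"
proof -
  have fA: "A t \<in> fmeasurable M" for t
    by (rule fmeasurableI2[OF I A(2) A(1)])
  have fU: "(\<Union>t\<in>J. A t) \<in> fmeasurable M" for J
    using I A by (intro fmeasurableI2[OF I]) auto
  have ge: "a\<^sup>2 / 2 * L \<le> measure M (\<Union>t\<in>{m..}. A t)" if m: "t0 \<le> m" for m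
  proof -
    \<comment> \<open>The near-diagonal terms will total at most 4 V, where V is the sum of
      \<open>v\<close> over the block; V \<ge> 4 lets V * V absorb them.\<close>
    have "\<exists>T. 4 \<le> (\<Sum>t\<in>{m..<T}. v t)"
    proof (rule ccontr)
      assume "\<not> ?thesis"
      then have b: "(\<Sum>t\<in>{m..<T}. v t) \<le> 4" for T
        by (meson linorder_not_le less_imp_le)
      have "(\<Sum>t<k. v (t + m)) \<le> 4" for k
        using b[of "k + m"] sum.shift_bounds_nat_ivl[of v 0 m k]
        by (simp add: atLeast0LessThan)
      then have "summable (\<lambda>t. v (t + m))"
        using v(1) by (intro summableI_nonneg_bounded[where x = 4]) auto
      then show False using v(2) by (simp add: summable_iff_shift)
    qed
    then obtain T where T: "4 \<le> (\<Sum>t\<in>{m..<T}. v t)" by blast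
    define F where "F = {m..<T}"
    define V where "V = (\<Sum>t\<in>F. v t)"
    define U where "U = measure M (\<Union>t\<in>F. A t)"
    \<comment> \<open>Since \<open>h s t\<close> vanishes for s > t, adding both orientations gives
      a pair bound that does not depend on the order of s and t.\<close>
    define h where "h s t = (if s \<le> t then (1/2) ^ (t - s) else 0 :: real)" for s t :: nat
    have V: "4 \<le> V" using T by (simp add: V_def F_def)
    have pair: "measure M (A s \<inter> A t) \<le> L * (v s * v t + h s t * v s + h t s * v t)"
      if "s \<in> F" "t \<in> F" for s t
    proof (cases "s \<le> t")
      case True
      have "measure M (A s \<inter> A t) \<le> L * (v s * v t + h s t * v s)"
        using upper[of s t] True that m by (simp add: F_def h_def)
      also have "\<dots> \<le> L * (v s * v t + h s t * v s + h t s * v t)"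
        using L v by (intro mult_left_mono) (auto simp: h_def)
      finally show ?thesis .
    next
      case False
      have "measure M (A t \<inter> A s) \<le> L * (v t * v s + h t s * v t)"
        using upper[of t s] False that m by (simp add: F_def h_def)
      also have "\<dots> \<le> L * (v s * v t + h s t * v s + h t s * v t)"
        using L v by (intro mult_left_mono) (auto simp: h_def)
      finally show ?thesis by (simp add: Int_commute)
    qed
    have hs: "(\<Sum>t\<in>F. h s t) \<le> 2" if "s \<in> F" for s
    proof -
      have "(\<Sum>t\<in>F. h s t) = (\<Sum>t\<in>{s..<T}. h s t)"
        using that by (intro sum.mono_neutral_right) (auto simp: F_def h_def)
      also have "\<dots> = (\<Sum>k<T - s. (1/2) ^ k)"
        by (rule sum.reindex_bij_witness[where i = "\<lambda>k. k + s" and j = "\<lambda>t. t - s"])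
           (auto simp: h_def)
      also have "\<dots> \<le> (\<Sum>k. (1/2) ^ k)"
        by (intro sum_le_suminf summable_geometric) auto
      also have "\<dots> = 2" by (simp add: suminf_geometric)
      finally show ?thesis .
    qed
    have hv: "(\<Sum>s\<in>F. \<Sum>t\<in>F. h s t * v s) \<le> 2 * V"
    proof -
      have "(\<Sum>s\<in>F. \<Sum>t\<in>F. h s t * v s) = (\<Sum>s\<in>F. (\<Sum>t\<in>F. h s t) * v s)"
        by (simp add: sum_distrib_right)
      also have "\<dots> \<le> (\<Sum>s\<in>F. 2 * v s)"
        using hs v by (intro sum_mono mult_right_mono) auto
      finally show ?thesis by (simp add: V_def sum_distrib_left)
    qed
    have "(\<Sum>s\<in>F. \<Sum>t\<in>F. measure M (A s \<inter> A t))
        \<le> (\<Sum>s\<in>F. \<Sum>t\<in>F. L * (v s * v t + h s t * v s + h t s * v t))"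
      by (intro sum_mono pair)
    also have "\<dots> = L * ((\<Sum>s\<in>F. \<Sum>t\<in>F. v s * v t) + (\<Sum>s\<in>F. \<Sum>t\<in>F. h s t * v s)
                     + (\<Sum>s\<in>F. \<Sum>t\<in>F. h t s * v t))"
      by (simp add: sum.distrib flip: sum_distrib_left)
    also have "(\<Sum>s\<in>F. \<Sum>t\<in>F. h t s * v t) = (\<Sum>s\<in>F. \<Sum>t\<in>F. h s t * v s)"
      by (rule sum.swap)
    also have "(\<Sum>s\<in>F. \<Sum>t\<in>F. v s * v t) = V * V"
      by (simp add: V_def sum_product)
    also have "L * (V * V + (\<Sum>s\<in>F. \<Sum>t\<in>F. h s t * v s) + (\<Sum>s\<in>F. \<Sum>t\<in>F. h s t * v s))
        \<le> L * (V * V + 4 * V)"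
      using hv L by (intro mult_left_mono) auto
    also have "\<dots> \<le> L * (V * V + V * V)"
      using V L by (intro mult_left_mono add_left_mono mult_right_mono) auto
    finally have up: "(\<Sum>s\<in>F. \<Sum>t\<in>F. measure M (A s \<inter> A t)) \<le> 2 * L * (V * V)"
      by simp
    have "a * L * V \<le> (\<Sum>t\<in>F. measure M (A t))"
      unfolding V_def sum_distrib_left using m lower by (intro sum_mono) (auto simp: F_def)
    then have "(a * L * V)\<^sup>2 \<le> (\<Sum>t\<in>F. measure M (A t))\<^sup>2"
      using a L V by (intro power_mono) auto
    also have "\<dots> \<le> U * (\<Sum>s\<in>F. \<Sum>t\<in>F. measure M (A s \<inter> A t))"
      unfolding U_def using fA by (intro sum_measure_squared_le) (auto simp: F_def)
    also have "\<dots> \<le> U * (2 * L * (V * V))"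
      using up by (intro mult_left_mono) (auto simp: U_def)
    finally have "(L * V\<^sup>2) * (a\<^sup>2 * L) \<le> (L * V\<^sup>2) * (2 * U)"
      by (simp add: power2_eq_square algebra_simps)
    then have "a\<^sup>2 * L \<le> 2 * U"
      using L V by (simp add: mult_le_cancel_left)
    also have "U \<le> measure M (\<Union>t\<in>{m..}. A t)"
      unfolding U_def using fU
      by (intro measure_mono_fmeasurable) (auto simp: F_def fmeasurable_def)
    finally show ?thesis by simp
  qed
  have eq: "limsup A = (\<Inter>m. \<Union>t\<in>{m..}. A t)"
    by (auto simp: limsup_INF_SUP)
  have "(\<lambda>m. measure M (\<Union>t\<in>{m..}. A t)) \<longlonglongrightarrow> measure M (\<Inter>m. \<Union>t\<in>{m..}. A t)"
  proof (rule Lim_measure_decseq)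
    show "range (\<lambda>m. \<Union>t\<in>{m..}. A t) \<subseteq> sets M"
      using fU by (auto simp: fmeasurable_def)
    show "decseq (\<lambda>m. \<Union>t\<in>{m..}. A t)"
      by (rule decseq_SucI, rule UN_mono) auto
    show "emeasure M (\<Union>t\<in>{m..}. A t) \<noteq> \<infinity>" for m
      using fU[of "{m..}"] by (auto simp: fmeasurable_def)
  qed
  then show ?thesis
    unfolding eq by (rule LIMSEQ_le_const) (use ge in blast)
qed

subsection \<open>The D-adic absolute value and the convergence case\<close>

lemma D_adic_sequence_dvd:
  assumes "D_adic_sequence n" "a \<le> b"
  shows "n a dvd n b"
  using assms(2,1) by (induction b rule: dec_induct) (auto simp: D_adic_sequence_def intro: dvd_trans)

lemma D_adic_sequence_pos:
  assumes "D_adic_sequence n"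
  shows "0 < n k"
  using assms strict_monoD[of n 0 k] by (cases k) (auto simp: D_adic_sequence_def)

lemma D_adic_abs_le:
  assumes "n m dvd q"
  shows "D_adic_abs n q \<le> 1 / real (n m)"
  unfolding D_adic_abs_def
  by (rule cInf_lower) (use assms in \<open>auto intro!: bdd_belowI[of _ 0]\<close>)

text \<open>Only m \<le> q can satisfy \<open>n m dvd q\<close>, and \<open>n 0 = 1\<close> always
  divides, so the infimum runs over a finite nonempty set.\<close>

lemma D_adic_abs_attained:
  assumes "D_adic_sequence n" "1 \<le> q"
  obtains m where "n m dvd q" "D_adic_abs n q = 1 / real (n m)"
proof -
  let ?S = "{1 / real (n m) | m. n m dvd q}"
  have "m \<le> q" if "n m dvd q" for m
    using strict_mono_imp_increasing[of n m] dvd_imp_le[OF that] assms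
    by (simp add: D_adic_sequence_def)
  then have "finite {m. n m dvd q}"
    by (auto intro: finite_subset[of _ "{..q}"])
  then have fin: "finite ?S"
    by (simp add: setcompr_eq_image)
  have "1 / real (n 0) \<in> ?S"
    using assms by (force simp: D_adic_sequence_def)
  then have "Inf ?S \<in> ?S"
    using fin by (metis (lifting) cInf_eq_Min Min_in empty_iff)
  then show ?thesis
    using that by (auto simp: D_adic_abs_def)
qed

text \<open>\<open>N\<close> is the first element of the sequence that is at least 1 / d. The
  elements form a divisibility chain, so any later element dividing q forces \<open>N\<close> to
  divide q. An element just before \<open>N\<close> is below 1 / d, hence a ratio bound C gives d N
  \<le> C; if there is none, \<open>N\<close> is 1.\<close>

lemma D_adic_abs_le_iff_dvd:
  assumes D: "D_adic_sequence n" and d: "0 < d"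
  obtains N where "0 < N" "1 \<le> d * real N"
    "\<And>q. 1 \<le> q \<Longrightarrow> D_adic_abs n q \<le> d \<longleftrightarrow> N dvd q"
    "\<And>C. d \<le> 1 \<Longrightarrow> 1 \<le> C \<Longrightarrow> (\<And>k. real (n (Suc k)) / real (n k) \<le> C) \<Longrightarrow> d * real N \<le> C"
proof -
  let ?P = "\<lambda>m. 1 \<le> d * real (n m)"
  define M where "M = (LEAST m. ?P m)"
  have pos: "0 < n k" for k using D by (rule D_adic_sequence_pos)
  obtain k :: nat where "1 / d \<le> real k" using real_arch_simple by blast
  moreover have "k \<le> n k"
    using D by (simp add: D_adic_sequence_def strict_mono_imp_increasing)
  ultimately have "1 / d \<le> real (n k)" by linarith
  then have "?P k" using d by (simp add: field_simps)
  then have M: "?P M" unfolding M_def by (rule LeastI)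
  have least: "M \<le> m" if "?P m" for m
    unfolding M_def using that by (rule Least_le)
  show ?thesis
  proof
    show "0 < n M" by (rule pos)
    show "1 \<le> d * real (n M)" by (rule M)
    show "D_adic_abs n q \<le> d \<longleftrightarrow> n M dvd q" if q: "1 \<le> q" for q
    proof
      assume le: "D_adic_abs n q \<le> d"
      obtain m where m: "n m dvd q" "D_adic_abs n q = 1 / real (n m)"
        using D_adic_abs_attained[OF D q] .
      then have "1 / real (n m) \<le> d" using le by simp
      then have "?P m" using pos[of m] by (simp add: field_simps)
      then have "n M dvd n m" by (intro D_adic_sequence_dvd[OF D] least)
      then show "n M dvd q" using m(1) by (rule dvd_trans)
    next
      assume "n M dvd q"
      then have "D_adic_abs n q \<le> 1 / real (n M)" by (rule D_adic_abs_le)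
      also have "\<dots> \<le> d" using M pos[of M] by (simp add: field_simps)
      finally show "D_adic_abs n q \<le> d" .
    qed
    show "d * real (n M) \<le> C"
      if "d \<le> 1" "1 \<le> C" and C: "\<And>k. real (n (Suc k)) / real (n k) \<le> C" for C
    proof (cases M)
      case 0
      then show ?thesis using D that by (simp add: D_adic_sequence_def)
    next
      case (Suc l)
      then have "\<not> ?P l" using least[of l] by auto
      then have l: "d * real (n l) \<le> 1" by simp
      have "d * real (n M) = (d * real (n l)) * (real (n (Suc l)) / real (n l))"
        using pos[of l] Suc by simp
      also have "\<dots> \<le> 1 * C"
        using l C[of l] d pos[of l] by (intro mult_mono) auto
      finally show ?thesis by simp
    qed
  qed
qed

lemma powr_inverse_le_iff:
  fixes a x y :: real
  assumes "0 < a" "0 \<le> x" "0 \<le> y"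
  shows "x powr (1 / a) \<le> y \<longleftrightarrow> x \<le> y powr a"
proof -
  have y: "(y powr a) powr (1 / a) = y" and x: "(x powr (1 / a)) powr a = x"
    using assms by (simp_all add: powr_powr)
  show ?thesis
    using powr_mono2[of a "x powr (1 / a)" y] powr_mono2[of "1 / a" x "y powr a"] assms
    unfolding x y by auto
qed

lemma nearest_int_dist_le_iff:
  "nearest_int_dist y \<le> e \<longleftrightarrow> \<bar>y - of_int (round y)\<bar> \<le> e"
proof
  assume le: "nearest_int_dist y \<le> e"
  have "closed (\<int> :: real set)" by simp
  then obtain z where "z \<in> (\<int> :: real set)" "infdist y \<int> = dist y z"
    using infdist_attains_inf[of \<int> y] Ints_0 by blast
  moreover then obtain a where "z = of_int a" by (auto elim: Ints_cases)
  ultimately show "\<bar>y - of_int (round y)\<bar> \<le> e"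
    using le round_diff_minimal[of y a] by (simp add: nearest_int_dist_def dist_real_def)
next
  assume "\<bar>y - of_int (round y)\<bar> \<le> e"
  then show "nearest_int_dist y \<le> e"
    unfolding nearest_int_dist_def by (intro infdist_le2[of "of_int (round y)"]) (auto simp: dist_real_def)
qed

lemma borel_measurable_nearest_int_dist [measurable]: "nearest_int_dist \<in> borel_measurable borel"
  unfolding nearest_int_dist_def
  by (intro borel_measurable_continuous_onI continuous_intros)

text \<open>Intervals of length 2 e / q around 0 / q, ..., q / q cover the set. Both endpoints
  occur, so there are q + 1 \<le> 2 q of them, whence the factor 4.\<close>

lemma emeasure_nearest_int_dist_le:
  assumes q: "1 \<le> q" and e: "0 \<le> e"
  shows "emeasure lborel {x \<in> {0..<1}. nearest_int_dist (real q * x) \<le> e} \<le> ennreal (4 * e)"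
proof -
  define J where "J a = {(real a - e) / real q .. (real a + e) / real q}" for a :: nat
  have J: "emeasure lborel (J a) = ennreal (2 * e / real q)" for a
    using q e by (simp add: J_def divide_right_mono flip: diff_divide_distrib)
  have sub: "{x \<in> {0..<1}. nearest_int_dist (real q * x) \<le> e} \<subseteq> (\<Union>a\<in>{..q}. J a)"
  proof
    fix x assume x: "x \<in> {x \<in> {0..<1}. nearest_int_dist (real q * x) \<le> e}"
    define a where "a = round (real q * x)"
    have "round (0::real) \<le> a"
      unfolding a_def by (rule round_mono) (use x in simp)
    moreover have "a \<le> round (real q)"
      unfolding a_def by (rule round_mono) (use x in \<open>simp add: mult_left_le\<close>)
    ultimately have a: "0 \<le> a" "nat a \<le> q" by auto
    have "\<bar>real q * x - of_int a\<bar> \<le> e"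
      using x by (simp add: nearest_int_dist_le_iff a_def)
    then have "x \<in> J (nat a)"
      using q a by (auto simp: J_def field_simps abs_le_iff)
    then show "x \<in> (\<Union>a\<in>{..q}. J a)" using a by auto
  qed
  have "emeasure lborel {x \<in> {0..<1}. nearest_int_dist (real q * x) \<le> e}
      \<le> emeasure lborel (\<Union>a\<in>{..q}. J a)"
    using sub by (intro emeasure_mono) (auto simp: J_def)
  also have "\<dots> \<le> (\<Sum>a\<in>{..q}. emeasure lborel (J a))"
    by (intro emeasure_subadditive_finite) (auto simp: J_def)
  also have "\<dots> = ennreal (\<Sum>a\<in>{..q}. 2 * e / real q)"
    unfolding J using e by (intro sum_ennreal) auto
  also have "(\<Sum>a\<in>{..q}. 2 * e / real q) = real (q + 1) * (2 * e / real q)"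
    by simp
  also have "\<dots> \<le> ennreal (4 * e)"
  proof (rule ennreal_leI)
    have "real (q + 1) * (2 * e / real q) \<le> (2 * real q) * (2 * e / real q)"
      using q e by (intro mult_right_mono) auto
    also have "\<dots> = 4 * e" using q by simp
    finally show "real (q + 1) * (2 * e / real q) \<le> 4 * e" .
  qed
  finally show ?thesis .
qed

lemma card_D_adic_abs_le:
  assumes D: "D_adic_sequence n" and d: "0 < d"
  shows "real (card {q\<in>{1..K}. D_adic_abs n q \<le> d}) \<le> d * real K"
proof -
  obtain N where N: "0 < N" "1 \<le> d * real N" "\<And>q. 1 \<le> q \<Longrightarrow> D_adic_abs n q \<le> d \<longleftrightarrow> N dvd q"
    using D_adic_abs_le_iff_dvd[OF D d] by metis
  have "{q\<in>{1..K}. D_adic_abs n q \<le> d} \<subseteq> (\<lambda>k. N * k) ` {1..K div N}"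
  proof
    fix q assume q: "q \<in> {q\<in>{1..K}. D_adic_abs n q \<le> d}"
    then obtain k where k: "q = N * k" using N(3)[of q] by auto
    then have "k \<le> K div N" using q N(1) by (auto simp: less_eq_div_iff_mult_less_eq mult.commute)
    then show "q \<in> (\<lambda>k. N * k) ` {1..K div N}" using q k by (cases "k = 0") auto
  qed
  then have "card {q\<in>{1..K}. D_adic_abs n q \<le> d} \<le> card ((\<lambda>k. N * k) ` {1..K div N})"
    by (intro card_mono) auto
  also have "\<dots> \<le> K div N" using card_image_le[of "{1..K div N}" "\<lambda>k. N * k"] by simp
  finally have "real (card {q\<in>{1..K}. D_adic_abs n q \<le> d}) \<le> real (K div N)" by simp
  also have "\<dots> \<le> real K / real N" by (rule of_nat_div_le_of_nat)
  also have "\<dots> \<le> d * real K"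
    using N(1,2) mult_right_mono[OF N(2), of "real K"] by (simp add: field_simps)
  finally show ?thesis .
qed

section \<open>Borel-Cantelli over dyadic blocks of denominators\<close>

lemma W_D_null:
  fixes i j :: real and n :: "nat \<Rightarrow> nat" and \<psi> :: "nat \<Rightarrow> real"
  assumes i: "i > 0" and j: "j > 0" and ij: "i + j = 1"
    and D: "D_adic_sequence n"
    and nonneg: "\<And>q. 1 \<le> q \<Longrightarrow> 0 \<le> \<psi> q"
    and decr: "\<And>p q. 1 \<le> p \<Longrightarrow> p \<le> q \<Longrightarrow> \<psi> q \<le> \<psi> p"
    and sum: "summable (\<lambda>t. 2 ^ t * \<psi> (2 ^ t))"
  shows "W_D n i j \<psi> \<in> null_sets lborel"
proof -
  define p where "p t = \<psi> (2 ^ t)" for t :: nat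
  \<comment> \<open>The range starts at 1 instead of \<open>2 ^ t\<close>: counting all multiples up
    to \<open>2 ^ Suc t\<close> costs only a constant.\<close>
  define G where "G t = {q\<in>{1..2 ^ Suc t}. D_adic_abs n q \<le> p t powr i}" for t
  define S where "S t q = {x \<in> {0..<1}. nearest_int_dist (real q * x) \<le> p t powr j}" for t q
  define B where "B t = (\<Union>q\<in>G t. S t q)" for t
  have p0: "0 \<le> p t" for t by (simp add: p_def nonneg)
  have absn: "0 < D_adic_abs n q" if "1 \<le> q" for q
    using D_adic_abs_attained[OF D that] D_adic_sequence_pos[OF D]
    by (metis of_nat_0_less_iff zero_less_divide_1_iff)
  have [measurable]: "S t q \<in> sets borel" for t q
    unfolding S_def by measurable
  have Bm [measurable]: "B t \<in> sets lborel" for t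
    unfolding B_def G_def by auto
  have Bb: "emeasure lborel (B t) \<le> ennreal (8 * (2 ^ t * p t))" for t
  proof -
    have fin: "finite (G t)" by (simp add: G_def)
    have "emeasure lborel (B t) \<le> (\<Sum>q\<in>G t. emeasure lborel (S t q))"
      unfolding B_def using fin by (intro emeasure_subadditive_finite) auto
    also have "\<dots> \<le> (\<Sum>q\<in>G t. ennreal (4 * p t powr j))"
      unfolding S_def by (intro sum_mono emeasure_nearest_int_dist_le) (auto simp: G_def)
    also have "\<dots> = ennreal (real (card (G t)) * (4 * p t powr j))"
      by (simp add: ennreal_mult ennreal_of_nat_eq_real_of_nat)
    also have "\<dots> \<le> ennreal (8 * (2 ^ t * p t))"
    proof (rule ennreal_leI, cases "p t = 0")
      case True
      \<comment> \<open>Here \<open>p t powr i = 0\<close>, while the D-adic absolute value of a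
        positive integer is positive.\<close>
      then have "G t = {}" using absn i by (force simp: G_def)
      then show "real (card (G t)) * (4 * p t powr j) \<le> 8 * (2 ^ t * p t)"
        using True by simp
    next
      case False
      then have pos: "p t > 0" using p0[of t] by simp
      then have "real (card (G t)) \<le> p t powr i * real (2 ^ Suc t)"
        unfolding G_def by (intro card_D_adic_abs_le[OF D]) auto
      then have "real (card (G t)) * (4 * p t powr j) \<le> p t powr i * real (2 ^ Suc t) * (4 * p t powr j)"
        by (intro mult_right_mono) auto
      also have "\<dots> = 8 * 2 ^ t * (p t powr i * p t powr j)" by simp
      also have "p t powr i * p t powr j = p t"
        using pos ij by (simp flip: powr_add)
      finally show "real (card (G t)) * (4 * p t powr j) \<le> 8 * (2 ^ t * p t)" by simp
    qed
    finally show ?thesis .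
  qed
  have "limsup B \<in> null_sets lborel"
  proof (rule borel_cantelli_limsup1[OF Bm])
    show "emeasure lborel (B t) < \<infinity>" for t
      using Bb[of t] by (simp add: order_le_less_trans)
    show "summable (\<lambda>t. measure lborel (B t))"
    proof (rule summable_comparison_test')
      show "summable (\<lambda>t. 8 * (2 ^ t * p t))"
        using sum unfolding p_def by (rule summable_mult)
      show "norm (measure lborel (B t)) \<le> 8 * (2 ^ t * p t)" for t
        using Bb[of t] p0[of t] by (simp add: measure_def enn2real_leI)
    qed
  qed
  moreover have "W_D n i j \<psi> \<subseteq> limsup B"
  proof
    fix x assume x: "x \<in> W_D n i j \<psi>"
    have "\<exists>t\<ge>m. x \<in> B t" for m
    proof -
      have "infinite {q. 1 \<le> q \<and>
          max (D_adic_abs n q powr (1 / i)) (nearest_int_dist (real q * x) powr (1 / j)) \<le> \<psi> q}"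
        using x by (simp add: W_D_def)
      then obtain q where q: "2 ^ m \<le> q" "1 \<le> q" "D_adic_abs n q powr (1 / i) \<le> \<psi> q"
         "nearest_int_dist (real q * x) powr (1 / j) \<le> \<psi> q"
        unfolding infinite_nat_iff_unbounded_le by auto
      obtain t where t: "2 ^ t \<le> q" "q < 2 ^ Suc t"
        using ex_power_ivl1[of 2 q] q(2) by auto
      have "m \<le> t"
      proof (rule ccontr)
        assume "\<not> m \<le> t"
        then have "(2::nat) ^ Suc t \<le> 2 ^ m" by (intro power_increasing) auto
        then show False using q(1) t(2) by simp
      qed
      moreover have le: "\<psi> q \<le> p t" unfolding p_def using t(1) by (intro decr) auto
      have "D_adic_abs n q \<le> p t powr i"
        using q(3) le i p0[of t] absn[OF q(2)] powr_inverse_le_iff[of i "D_adic_abs n q" "p t"] by simp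
      moreover have "nearest_int_dist (real q * x) \<le> p t powr j"
        using q(4) le j p0[of t] powr_inverse_le_iff[of j "nearest_int_dist (real q * x)" "p t"]
        by (simp add: nearest_int_dist_def infdist_nonneg)
      ultimately show ?thesis
        using x q(2) t(2) by (intro exI[of _ t]) (auto simp: B_def G_def S_def W_D_def)
    qed
    then show "x \<in> limsup B" by (auto simp: limsup_INF_SUP Bex_def)
  qed
  ultimately show ?thesis
    using W_D_measurable by (metis null_sets_subset sets_lborel)
qed

subsection \<open>Neighbourhoods of separated sets\<close>

definition separated :: "real \<Rightarrow> real set \<Rightarrow> bool" where
  "separated d P \<longleftrightarrow> (\<forall>x\<in>P. \<forall>y\<in>P. x \<noteq> y \<longrightarrow> d \<le> \<bar>x - y\<bar>)"

definition nbhd :: "real set \<Rightarrow> real \<Rightarrow> real set" where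
  "nbhd P r = (\<Union>p\<in>P. {p - r<..<p + r})"

lemma separated_subset: "separated d P \<Longrightarrow> P' \<subseteq> P \<Longrightarrow> separated d P'"
  by (auto simp: separated_def)

lemma separated_mono: "separated d P \<Longrightarrow> d' \<le> d \<Longrightarrow> separated d' P"
  by (force simp: separated_def)

text \<open>Points at least d apart have different values of the floor of (x - a) / d, so counting
  reduces to counting integers.\<close>

lemma separated_card:
  assumes sep: "separated d P" and d: "0 < d" and P: "P \<subseteq> {a..b}" and ab: "a \<le> b"
  shows "finite P" "real (card P) \<le> 1 + (b - a) / d"
proof -
  define f where "f x = \<lfloor>(x - a) / d\<rfloor>" for x
  have less: "f x < f y" if "x \<in> P" "y \<in> P" "x < y" for x y
  proof -
    have "d \<le> \<bar>x - y\<bar>"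
      using sep that unfolding separated_def by (metis less_irrefl)
    then have "d \<le> y - x" using that by simp
    then have "(x - a + d) / d \<le> (y - a) / d" using d by (intro divide_right_mono) auto
    then have "(x - a) / d + 1 \<le> (y - a) / d" using d by (simp add: add_divide_distrib)
    then show ?thesis unfolding f_def by linarith
  qed
  have inj: "inj_on f P"
    by (rule inj_onI) (metis less less_irrefl linorder_neqE_linordered_idom)
  have im: "f ` P \<subseteq> {0..\<lfloor>(b - a) / d\<rfloor>}"
    using P d by (force simp: f_def intro!: floor_mono divide_right_mono)
  show "finite P" using inj im by (meson finite_atLeastAtMost_int finite_imageD finite_subset)
  have "card P = card (f ` P)" using inj by (simp add: card_image)
  also have "\<dots> \<le> card {0..\<lfloor>(b - a) / d\<rfloor>}" using im by (intro card_mono) auto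
  finally have "card P \<le> nat (\<lfloor>(b - a) / d\<rfloor> + 1)" by simp
  moreover have "0 \<le> \<lfloor>(b - a) / d\<rfloor>" using ab d by simp
  ultimately show "real (card P) \<le> 1 + (b - a) / d" by linarith
qed

lemma nbhd_measurable [measurable]: "nbhd P r \<in> sets borel"
  unfolding nbhd_def by (intro borel_open open_UN) auto

lemma measure_nbhd:
  assumes "finite P" "separated d P" "0 \<le> r" "2 * r \<le> d"
  shows "measure lborel (nbhd P r) = real (card P) * (2 * r)"
proof -
  have "measure lborel (nbhd P r) = (\<Sum>p\<in>P. measure lborel {p - r<..<p + r})"
    unfolding nbhd_def
  proof (rule measure_finite_Union)
    show "disjoint_family_on (\<lambda>p. {p - r<..<p + r}) P"
      unfolding disjoint_family_on_def
    proof (intro ballI impI)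
      fix x y assume "x \<in> P" "y \<in> P" "x \<noteq> y"
      then have "d \<le> \<bar>x - y\<bar>" using assms by (auto simp: separated_def)
      then show "{x - r<..<x + r} \<inter> {y - r<..<y + r} = {}" using assms by auto
    qed
  qed (use assms in auto)
  then show ?thesis using assms by simp
qed

text \<open>If the intervals around p and p' meet, then p' lies within 2 r of p. Separation leaves
  at most 1 + 4 r / d such p' for each p.\<close>

lemma measure_nbhd_Int_le:
  assumes P: "finite P" and P': "finite P'" "separated d P'" and d: "0 < d"
    and r: "0 \<le> r'" "r' \<le> r"
  shows "measure lborel (nbhd P r \<inter> nbhd P' r')
           \<le> real (card P) * ((1 + 4 * r / d) * (2 * r'))"
proof -
  define J where "J p = P' \<inter> {p - 2 * r..p + 2 * r}" for p
  have fin: "finite (J p)" for p using P' by (simp add: J_def)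
  have cJ: "real (card (J p)) \<le> 1 + 4 * r / d" for p
    using separated_card(2)[of d "J p" "p - 2 * r" "p + 2 * r"] P' d r
    by (auto simp: J_def intro: separated_subset)
  have sub: "nbhd P r \<inter> nbhd P' r' \<subseteq> (\<Union>p\<in>P. nbhd (J p) r')"
  proof
    fix x assume "x \<in> nbhd P r \<inter> nbhd P' r'"
    then obtain p p' where p: "p \<in> P" "p - r < x" "x < p + r"
      and p': "p' \<in> P'" "p' - r' < x" "x < p' + r'"
      by (auto simp: nbhd_def)
    then have "p' \<in> J p" using r by (auto simp: J_def)
    then show "x \<in> (\<Union>p\<in>P. nbhd (J p) r')" using p p' by (auto simp: nbhd_def)
  qed
  have fm: "nbhd (J p) r' \<in> fmeasurable lborel" for p
    unfolding nbhd_def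
    by (intro fmeasurable.finite_UN fin) (use r in \<open>auto simp: fmeasurable_def\<close>)
  have "measure lborel (nbhd P r \<inter> nbhd P' r') \<le> measure lborel (\<Union>p\<in>P. nbhd (J p) r')"
    using sub fm P by (intro measure_mono_fmeasurable fmeasurable.finite_UN) auto
  also have "\<dots> \<le> (\<Sum>p\<in>P. measure lborel (nbhd (J p) r'))"
    using P by (intro measure_UNION_le) auto
  also have "\<dots> \<le> (\<Sum>p\<in>P. (1 + 4 * r / d) * (2 * r'))"
  proof (rule sum_mono)
    fix p
    have "measure lborel (nbhd (J p) r') \<le> (\<Sum>y\<in>J p. measure lborel {y - r'<..<y + r'})"
      unfolding nbhd_def by (intro measure_UNION_le fin) auto
    also have "\<dots> = real (card (J p)) * (2 * r')" using r by simp
    also have "\<dots> \<le> (1 + 4 * r / d) * (2 * r')" using cJ r by (intro mult_right_mono) auto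
    finally show "measure lborel (nbhd (J p) r') \<le> (1 + 4 * r / d) * (2 * r')" .
  qed
  finally show ?thesis by simp
qed

subsection \<open>Counting fractions\<close>

text \<open>The term g = 2 is kept exact and the rest telescopes through 1 / g^2 \<le> 1 / (g - 1) -
  1 / g. A bound below 1 is what leaves a positive proportion of coprime pairs.\<close>

lemma sum_inverse_squares_le: "(\<Sum>g=2..Q. 1 / (real g)\<^sup>2) \<le> 3 / 4"
proof -
  have *: "(\<Sum>g=2..k+2. 1 / (real g)\<^sup>2) \<le> 3 / 4 - 1 / (real k + 2)" for k
  proof (induction k)
    case 0
    then show ?case by simp
  next
    case (Suc k)
    have "1 / (real k + 3)\<^sup>2 \<le> 1 / ((real k + 2) * (real k + 3))"
      unfolding power2_eq_square by (intro divide_left_mono mult_right_mono) auto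
    also have "\<dots> = 1 / (real k + 2) - 1 / (real k + 3)"
      by (simp add: divide_simps)
    finally show ?case using Suc by (simp add: add.commute)
  qed
  show ?thesis
  proof (cases "Q \<ge> 2")
    case True
    then obtain k where Q: "Q = k + 2" by (metis add.commute le_Suc_ex)
    have "0 \<le> 1 / (real k + 2)" by simp
    then show ?thesis unfolding Q using *[of k] by linarith
  qed auto
qed

text \<open>Fractions in (0, 1]; forming a set removes the repetitions of unreduced ones. Leaving
  out 0 makes integer translates disjoint.\<close>

definition farey :: "nat \<Rightarrow> real set" where
  "farey Q = {real a / real q | a q. 1 \<le> a \<and> a \<le> q \<and> q \<le> Q}"

lemma finite_farey: "finite (farey Q)"
proof -
  have "farey Q \<subseteq> (\<lambda>(a, q). real a / real q) ` ({..Q} \<times> {..Q})"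
    by (force simp: farey_def)
  then show ?thesis by (rule finite_subset) auto
qed

text \<open>A pair with gcd g \<ge> 2 is g times a pair from a square of side Q div g, so the
  non-coprime pairs number at most Q^2 times the sum of 1 / g^2.\<close>

lemma card_coprime_pairs_ge:
  "(real Q)\<^sup>2 / 4 \<le> real (card {(a, q). a \<in> {1..Q} \<and> q \<in> {1..Q} \<and> coprime a q})"
proof -
  let ?B = "{1..Q} \<times> {1..Q}"
  define C where "C = {(a, q). a \<in> {1..Q} \<and> q \<in> {1..Q} \<and> coprime a q}"
  define S where "S g = (\<lambda>(a, b). (g * a, g * b)) ` ({1..Q div g} \<times> {1..Q div g})" for g
  have "?B \<subseteq> C \<union> (\<Union>g\<in>{2..Q}. S g)"
  proof
    fix z assume "z \<in> ?B"
    then obtain a q where z: "z = (a, q)" "a \<in> {1..Q}" "q \<in> {1..Q}" by auto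
    show "z \<in> C \<union> (\<Union>g\<in>{2..Q}. S g)"
    proof (cases "coprime a q")
      case True
      then show ?thesis using z by (simp add: C_def)
    next
      case False
      define g where "g = gcd a q"
      obtain a' q' where aq: "a = g * a'" "q = g * q'"
        unfolding g_def by (meson dvd_def gcd_dvd1 gcd_dvd2)
      have "g \<noteq> 0" "g \<noteq> 1" using False z by (auto simp: g_def coprime_iff_gcd_eq_1)
      moreover have "g \<le> a" unfolding g_def using z by (intro gcd_le1_nat) auto
      ultimately have g: "g \<in> {2..Q}" using z by auto
      have "a' \<in> {1..Q div g}" "q' \<in> {1..Q div g}"
        using aq z \<open>g \<noteq> 0\<close> by (auto simp: less_eq_div_iff_mult_less_eq mult.commute Suc_le_eq)
      then have "z \<in> S g" using z aq by (auto simp: S_def)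
      then show ?thesis using g by blast
    qed
  qed
  moreover have fC: "finite C"
    by (rule finite_subset[of _ ?B]) (auto simp: C_def)
  ultimately have "card ?B \<le> card (C \<union> (\<Union>g\<in>{2..Q}. S g))"
    by (intro card_mono) (auto simp: S_def)
  also have "\<dots> \<le> card C + card (\<Union>g\<in>{2..Q}. S g)" by (rule card_Un_le)
  also have "card (\<Union>g\<in>{2..Q}. S g) \<le> (\<Sum>g=2..Q. card (S g))" by (rule card_UN_le) auto
  finally have "Q\<^sup>2 \<le> card C + (\<Sum>g=2..Q. card (S g))" by (simp add: power2_eq_square)
  then have "(real Q)\<^sup>2 \<le> real (card C) + (\<Sum>g=2..Q. real (card (S g)))"
    by (metis of_nat_add of_nat_le_iff of_nat_power of_nat_sum)
  also have "(\<Sum>g=2..Q. real (card (S g))) \<le> (\<Sum>g=2..Q. (real Q)\<^sup>2 * (1 / (real g)\<^sup>2))"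
  proof (rule sum_mono)
    fix g
    have "card (S g) \<le> (Q div g)\<^sup>2"
      unfolding S_def by (rule order_trans[OF card_image_le]) (auto simp: power2_eq_square)
    then have "real (card (S g)) \<le> (real (Q div g))\<^sup>2" by (metis of_nat_le_iff of_nat_power)
    also have "\<dots> \<le> (real Q / real g)\<^sup>2" by (intro power_mono of_nat_div_le_of_nat) auto
    finally show "real (card (S g)) \<le> (real Q)\<^sup>2 * (1 / (real g)\<^sup>2)" by (simp add: power_divide)
  qed
  also have "\<dots> = (real Q)\<^sup>2 * (\<Sum>g=2..Q. 1 / (real g)\<^sup>2)" by (simp add: sum_distrib_left)
  also have "\<dots> \<le> (real Q)\<^sup>2 * (3 / 4)" by (intro mult_left_mono sum_inverse_squares_le) auto
  finally show ?thesis by (simp add: C_def)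
qed

text \<open>Reflection shows that at least half of the coprime pairs have a \<le> q, and distinct
  reduced pairs give distinct fractions.\<close>

lemma card_farey_ge: "(real Q)\<^sup>2 / 8 \<le> real (card (farey Q))"
proof -
  define C where "C = {(a, q). a \<in> {1..Q} \<and> q \<in> {1..Q} \<and> coprime a q}"
  define K where "K = {z \<in> C. fst z \<le> snd z}"
  have fC: "finite C"
    by (rule finite_subset[of _ "{1..Q} \<times> {1..Q}"]) (auto simp: C_def)
  have "C \<subseteq> K \<union> prod.swap ` K"
    by (force simp: K_def C_def coprime_commute image_iff)
  then have "card C \<le> card (K \<union> prod.swap ` K)"
    using fC by (intro card_mono) (auto simp: K_def)
  also have "\<dots> \<le> card K + card (prod.swap ` K)" by (rule card_Un_le)
  also have "card (prod.swap ` K) \<le> card K" using fC by (intro card_image_le) (auto simp: K_def)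
  finally have "card C \<le> 2 * card K" by simp
  moreover have "card K \<le> card (farey Q)"
  proof (rule card_inj_on_le[OF _ _ finite_farey])
    show "inj_on (\<lambda>(a, q). real a / real q) K"
    proof (rule inj_onI, clarify)
      fix a q b r assume aq: "(a, q) \<in> K" and br: "(b, r) \<in> K" and "real a / real q = real b / real r"
      then have "real (a * r) = real (b * q)" by (auto simp: K_def C_def field_simps)
      then have "a * r = b * q" by (simp only: of_nat_eq_iff)
      then show "a = b \<and> q = r"
        using aq br coprime_crossproduct_nat[of a q b r]
        by (auto simp: K_def C_def mult.commute)
    qed
    show "(\<lambda>(a, q). real a / real q) ` K \<subseteq> farey Q"
      by (fastforce simp: K_def C_def farey_def)
  qed
  ultimately show ?thesis
    using card_coprime_pairs_ge[of Q] unfolding C_def[symmetric] by linarith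
qed

text \<open>With \<open>Q = 2 ^ t div N\<close> the denominators are exactly the multiples of N up
  to \<open>2 ^ t\<close>. Numerators are arbitrary integers, so the set is periodic with period 1 /
  N.\<close>

definition frac_grid :: "nat \<Rightarrow> nat \<Rightarrow> real set" where
  "frac_grid N Q = {of_int a / (real N * real q) | a q. 1 \<le> q \<and> q \<le> Q}"

text \<open>Since N is common to both denominators, a difference has the form z / (N q r) with a
  single factor N and a nonzero integer z.\<close>

lemma separated_frac_grid:
  assumes N: "0 < N"
  shows "separated (1 / (real N * (real Q)\<^sup>2)) (frac_grid N Q)"
  unfolding separated_def
proof (intro ballI impI)
  fix x y assume "x \<in> frac_grid N Q" "y \<in> frac_grid N Q" and ne: "x \<noteq> y"
  then obtain a q b r where x: "x = of_int a / (real N * real q)" and q: "1 \<le> q" "q \<le> Q"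
    and y: "y = of_int b / (real N * real r)" and r: "1 \<le> r" "r \<le> Q"
    unfolding frac_grid_def by blast
  define z where "z = a * int r - b * int q"
  have eq: "x - y = of_int z / (real N * (real q * real r))"
    using N q r by (simp add: x y z_def field_simps)
  then have "z \<noteq> 0" using ne by auto
  then have z: "1 \<le> \<bar>of_int z :: real\<bar>" by linarith
  have "real q * real r \<le> (real Q)\<^sup>2"
    unfolding power2_eq_square using q r by (intro mult_mono) auto
  then have "1 / (real N * (real Q)\<^sup>2) \<le> 1 / (real N * (real q * real r))"
    using N q r by (intro divide_left_mono mult_left_mono) auto
  also have "\<dots> \<le> \<bar>of_int z\<bar> / (real N * (real q * real r))"
    using z by (intro divide_right_mono) auto
  also have "\<dots> = \<bar>x - y\<bar>" by (simp add: eq abs_mult)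
  finally show "1 / (real N * (real Q)\<^sup>2) \<le> \<bar>x - y\<bar>" .
qed

lemma card_frac_grid_ge:
  assumes N: "0 < N" and Q: "0 < Q" and long: "4 \<le> real N * (w - u)"
  shows "real N * (w - u) / 16 * (real Q)\<^sup>2 \<le> real (card (frac_grid N Q \<inter> {u..w}))"
proof -
  have "u \<le> w" using N long by (smt (verit) mult_nonneg_nonpos of_nat_0_le_iff)
  \<comment> \<open>The k for which the whole period from k / N to (k + 1) / N lies in [u, w]; each
    holds a scaled copy of the Farey fractions.\<close>
  define K where "K = {\<lceil>real N * u\<rceil>..\<lfloor>real N * w\<rfloor> - 1}"
  define f where "f = (\<lambda>(k, y). (of_int k + y) / real N)"
  have fin: "finite (frac_grid N Q \<inter> {u..w})"
    using separated_card(1)[OF separated_subset[OF separated_frac_grid[OF N, of Q]],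
        of "frac_grid N Q \<inter> {u..w}" u w] N Q \<open>u \<le> w\<close> by auto
  have fy: "0 < y \<and> y \<le> 1" if "y \<in> farey Q" for y
    using that by (auto simp: farey_def)
  have "inj_on f (K \<times> farey Q)"
  proof (rule inj_onI, clarify)
    fix k l y z assume y: "y \<in> farey Q" and z: "z \<in> farey Q" and "f (k, y) = f (l, z)"
    then have eq: "of_int k + y = of_int l + z" using N by (simp add: f_def)
    then have "k = l" using fy[OF y] fy[OF z] by linarith
    then show "k = l \<and> y = z" using eq by simp
  qed
  moreover have "f ` (K \<times> farey Q) \<subseteq> frac_grid N Q \<inter> {u..w}"
  proof clarify
    fix k y assume k: "k \<in> K" and y: "y \<in> farey Q"
    obtain a q where aq: "y = real a / real q" "1 \<le> a" "a \<le> q" "q \<le> Q"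
      using y by (auto simp: farey_def)
    have "f (k, y) = of_int (k * int q + int a) / (real N * real q)"
      using aq N by (simp add: f_def field_simps)
    then have "f (k, y) \<in> frac_grid N Q"
      unfolding frac_grid_def using aq(2-)
      by (intro CollectI exI[of _ "k * int q + int a"] exI[of _ q] conjI) auto
    moreover have "real N * u \<le> of_int k"
      using k by (simp add: K_def ceiling_le_iff)
    moreover have "of_int k + 1 \<le> real N * w"
      using k by (simp add: K_def) linarith
    ultimately have "f (k, y) \<in> frac_grid N Q" "u \<le> f (k, y)" "f (k, y) \<le> w"
      using fy[OF y] N by (auto simp: f_def field_simps)
    then show "f (k, y) \<in> frac_grid N Q \<inter> {u..w}" by simp
  qed
  ultimately have "card (K \<times> farey Q) \<le> card (frac_grid N Q \<inter> {u..w})"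
    using fin by (intro card_inj_on_le)
  then have le: "real (card K) * real (card (farey Q)) \<le> real (card (frac_grid N Q \<inter> {u..w}))"
    by (simp add: card_cartesian_product flip: of_nat_mult)
  \<comment> \<open>Rounding at the two ends loses at most two periods, which by \<open>long\<close>
    is at most half of them.\<close>
  have "real N * (w - u) / 2 \<le> real N * (w - u) - 2"
    using long by linarith
  also have "\<dots> = real N * w - real N * u - 2"
    by (simp add: right_diff_distrib)
  also have "\<dots> \<le> real (card K)"
    unfolding K_def by simp linarith
  finally have "real N * (w - u) / 2 \<le> real (card K)" .
  then have "real N * (w - u) / 2 * ((real Q)\<^sup>2 / 8) \<le> real (card K) * real (card (farey Q))"
    using long by (intro mult_mono card_farey_ge) auto
  with le show ?thesis by simp
qed

subsection \<open>The divergence case\<close>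

lemma limsup_nbhd_frac_grid_full:
  fixes N :: "nat \<Rightarrow> nat" and e :: "nat \<Rightarrow> real"
  assumes N: "\<And>t. 0 < N t" and N_inf: "filterlim N at_top sequentially"
    and e: "\<And>t. 0 \<le> e t" and decr: "\<And>s t. s \<le> t \<Longrightarrow> e t \<le> e s"
    and small: "\<And>t. 2 ^ t * e t \<le> real (N t)"
    and div: "\<not> summable (\<lambda>t. if N t \<le> 2 ^ t then 2 ^ t * e t / real (N t) else 0)"
  shows "- limsup (\<lambda>t. nbhd (frac_grid (N t) (2 ^ t div N t)) (e t / (4 * 2 ^ t))) \<in> null_sets lborel"
proof -
  define Q where "Q t = 2 ^ t div N t" for t
  define r where "r t = e t / (4 * 2 ^ t)" for t
  \<comment> \<open>By \<open>rd\<close>, \<open>v t\<close> is four times the ratio of the radius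
    \<open>r t\<close> to the separation \<open>d t\<close>, so up to constants it is the proportion
    of a fixed interval that the neighbourhoods cover for large t. It is 0 when the grid is
    empty.\<close>
  define v where "v t = (if N t \<le> 2 ^ t then 2 ^ t * e t / real (N t) else 0)" for t
  define d where "d t = real (N t) / 4 ^ t" for t
  define R where "R t = nbhd (frac_grid (N t) (Q t)) (r t)" for t
  have v0: "0 \<le> v t" for t using e N by (simp add: v_def)
  have v1: "v t \<le> 1" for t using small[of t] N[of t] by (simp add: v_def)
  have d0: "0 < d t" for t using N by (simp add: d_def)
  have r0: "0 \<le> r t" for t using e by (simp add: r_def)
  have four: "(4::real) ^ t = 2 ^ t * 2 ^ t" for t :: nat by (simp flip: power_mult_distrib)
  have rd: "r t = d t * v t / 4" if "N t \<le> 2 ^ t" for t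
    using that N[of t] by (simp add: r_def d_def v_def four field_simps)
  \<comment> \<open>Because \<open>e\<close> decreases, the radius at least halves from one block to
    the next; this is the source of the geometric error term.\<close>
  have r_decay: "r t \<le> (1/2) ^ (t - s) * r s" if "s \<le> t" for s t
  proof -
    have "2 ^ t = (2::real) ^ (t - s) * 2 ^ s" using that by (simp flip: power_add)
    then have "r t = (1/2) ^ (t - s) * (e t / (4 * 2 ^ s))" by (simp add: r_def power_one_over field_simps)
    also have "\<dots> \<le> (1/2) ^ (t - s) * r s"
      unfolding r_def using decr[OF that] by (intro mult_left_mono divide_right_mono) auto
    finally show ?thesis .
  qed
  have r_decr: "r t \<le> r s" if "s \<le> t" for s t
  proof -
    have "(1/2 :: real) ^ (t - s) * r s \<le> 1 * r s"
      by (intro mult_right_mono power_le_one r0) auto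
    then show ?thesis using r_decay[OF that] by linarith
  qed
  have R_empty: "R t = {}" if "\<not> N t \<le> 2 ^ t" for t
    using that by (simp add: R_def Q_def nbhd_def frac_grid_def)
  have sepd: "separated (d t) (frac_grid (N t) (Q t))" if "N t \<le> 2 ^ t" for t
  proof (rule separated_mono[OF separated_frac_grid[OF N]])
    have "Q t * N t \<le> 2 ^ t" by (simp add: Q_def)
    then have "real (Q t) * real (N t) \<le> 2 ^ t" by (metis of_nat_le_iff of_nat_mult of_nat_numeral of_nat_power)
    then have "(real (Q t) * real (N t))\<^sup>2 \<le> (2 ^ t)\<^sup>2" by (intro power_mono) auto
    then have "real (N t) * (real (N t) * (real (Q t))\<^sup>2) \<le> 4 ^ t"
      by (simp add: four power2_eq_square algebra_simps)
    moreover have "0 < Q t" using that N[of t] by (simp add: Q_def div_greater_zero_iff)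
    ultimately show "d t \<le> 1 / (real (N t) * (real (Q t))\<^sup>2)"
      using N[of t] by (simp add: d_def field_simps)
  qed
  \<comment> \<open>The rounding in \<open>Q t\<close> loses at most a factor 2 because
    \<open>Q t\<close> is at least 1.\<close>
  have Q_ge: "4 ^ t \<le> 4 * (real (N t) * real (Q t))\<^sup>2" if "N t \<le> 2 ^ t" for t
  proof -
    have Q1: "1 \<le> Q t" using that N[of t] by (simp add: Q_def Suc_le_eq div_greater_zero_iff)
    have "2 ^ t < N t * (Q t + 1)"
      unfolding Q_def using N[of t] by (simp add: dividend_less_times_div)
    also have "\<dots> \<le> N t * (2 * Q t)" using Q1 by (intro mult_left_mono) auto
    finally have "2 ^ t \<le> 2 * (N t * Q t)" by simp
    then have "2 ^ t \<le> 2 * (real (N t) * real (Q t))"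
      by (metis of_nat_le_iff of_nat_mult of_nat_numeral of_nat_power)
    then have "(2 ^ t)\<^sup>2 \<le> (2 * (real (N t) * real (Q t)))\<^sup>2" by (intro power_mono) auto
    then show ?thesis by (simp add: four power2_eq_square)
  qed
  have "- limsup R \<in> null_sets lborel"
  proof (rule full_measure_if_positive_proportion_on_intervals)
    have [measurable]: "R t \<in> sets borel" for t by (simp add: R_def)
    show Rm: "limsup R \<in> sets borel" by measurable
    \<comment> \<open>\<open>limsup_measure_ge\<close> is used with a = 1/256, which arises as L /
      (128 d) * 2 r = L v / 256 from \<open>cardP_ge\<close> and \<open>rd\<close>.\<close>
    show "0 < (1/256 :: real)\<^sup>2 / 2" by simp
    fix a b :: real assume ab: "a < b"
    define L where "L = b - a"
    \<comment> \<open>Only grid points in the middle half are kept, so that neighbourhoods of radius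
      at most L / 4 stay inside (a, b).\<close>
    define u where "u = a + L / 4"
    define w where "w = b - L / 4"
    define P where "P t = frac_grid (N t) (Q t) \<inter> {u..w}" for t
    define A where "A t = nbhd (P t) (r t) \<inter> {a<..<b}" for t
    have L: "0 < L" and wu: "w - u = L / 2" "u \<le> w"
      using ab by (auto simp: L_def u_def w_def field_simps)
    have lim: "(\<lambda>t. (1/2) ^ t) \<longlonglongrightarrow> (0::real)" by (intro LIMSEQ_realpow_zero) auto
    \<comment> \<open>The three conditions on t serve, in order, to absorb the 1 in
      \<open>separated_card\<close> (\<open>cardP_le\<close>), to keep the neighbourhoods inside the
      interval (\<open>A_eq\<close>), and to supply the length hypothesis of
      \<open>card_frac_grid_ge\<close> (\<open>cardP_ge\<close>).\<close>
    have "eventually (\<lambda>t. (1/2) ^ t < L) sequentially"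
      using order_tendstoD(2)[OF lim] L by auto
    moreover have "eventually (\<lambda>t. (1/2) ^ t * r 0 < L / 4) sequentially"
      using order_tendstoD(2)[OF tendsto_mult_left_zero[OF lim], of "L / 4" "r 0"] L by simp
    moreover have "eventually (\<lambda>t. nat \<lceil>8 / L\<rceil> \<le> N t) sequentially"
      using N_inf unfolding filterlim_at_top by blast
    ultimately have "eventually (\<lambda>t. (1/2) ^ t < L \<and> (1/2) ^ t * r 0 < L / 4 \<and> nat \<lceil>8 / L\<rceil> \<le> N t) sequentially"
      by eventually_elim auto
    then obtain t0 where t0: "\<And>t. t0 \<le> t \<Longrightarrow>
        (1/2) ^ t < L \<and> (1/2) ^ t * r 0 < L / 4 \<and> nat \<lceil>8 / L\<rceil> \<le> N t"
      unfolding eventually_sequentially by blast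
    have A_empty: "A t = {}" if "\<not> N t \<le> 2 ^ t" for t
      using R_empty[OF that] by (auto simp: A_def P_def R_def nbhd_def)
    have A_eq: "A t = nbhd (P t) (r t)" if "t0 \<le> t" for t
    proof -
      have "r t \<le> L / 4" using t0[OF that] r_decay[of 0 t] by simp
      then show ?thesis by (force simp: A_def P_def nbhd_def u_def w_def)
    qed
    have sepP: "separated (d t) (P t)" if "N t \<le> 2 ^ t" for t
      using sepd[OF that] by (rule separated_subset) (auto simp: P_def)
    have finP: "finite (P t)" if "N t \<le> 2 ^ t" for t
      by (rule separated_card(1)[OF sepP[OF that] d0 _ wu(2)]) (simp add: P_def)
    have cardP_le: "real (card (P t)) \<le> 2 * L / d t" if "N t \<le> 2 ^ t" "t0 \<le> t" for t
    proof -
      have "real (N t) \<le> 2 ^ t"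
        using that(1) by (metis of_nat_le_iff of_nat_numeral of_nat_power)
      then have "d t \<le> (1/2) ^ t" by (simp add: d_def four power_one_over field_simps)
      then have "d t \<le> L" using t0[OF that(2)] by linarith
      then have "1 \<le> L / d t" using d0[of t] by (simp add: field_simps)
      moreover have "real (card (P t)) \<le> 1 + (w - u) / d t"
        by (rule separated_card(2)[OF sepP[OF that(1)] d0 _ wu(2)]) (simp add: P_def)
      ultimately show ?thesis using wu(1) by (simp add: field_simps)
    qed
    have cardP_ge: "L / (128 * d t) \<le> real (card (P t))" if "N t \<le> 2 ^ t" "t0 \<le> t" for t
    proof -
      have "8 / L \<le> real (N t)" using t0[OF that(2)] by linarith
      then have long: "4 \<le> real (N t) * (w - u)" using L by (simp add: wu field_simps)
      have "L / (128 * d t) = L / (128 * real (N t)) * 4 ^ t"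
        by (simp add: d_def)
      also have "\<dots> \<le> L / (128 * real (N t)) * (4 * (real (N t) * real (Q t))\<^sup>2)"
        using L Q_ge[OF that(1)] by (intro mult_left_mono) auto
      also have "\<dots> = real (N t) * (w - u) / 16 * (real (Q t))\<^sup>2"
        using N[of t] by (simp add: wu power2_eq_square)
      also have "\<dots> \<le> real (card (P t))"
        unfolding P_def using long that(1) N[of t]
        by (intro card_frac_grid_ge) (auto simp: Q_def div_greater_zero_iff)
      finally show ?thesis .
    qed
    have "(1/256)\<^sup>2 / 2 * L \<le> measure lborel (limsup A)"
    proof (rule limsup_measure_ge[where I = "{a<..<b}" and v = v and ?t0.0 = t0])
      show "{a<..<b} \<in> fmeasurable lborel" using ab by (auto simp: fmeasurable_def)
      show "A t \<in> sets lborel" "A t \<subseteq> {a<..<b}" for t by (auto simp: A_def)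
      show "\<not> summable v" using div by (simp add: v_def[abs_def])
      show "1 / 256 * L * v t \<le> measure lborel (A t)" if t: "t0 \<le> t" for t
      proof (cases "N t \<le> 2 ^ t")
        case True
        have "d t * v t \<le> d t" using v1 d0[of t] by (simp add: mult_left_le)
        then have "2 * r t \<le> d t" using rd[OF True] d0[of t] by linarith
        then have "measure lborel (A t) = real (card (P t)) * (2 * r t)"
          using A_eq[OF t] measure_nbhd[OF finP[OF True] sepP[OF True] r0] by simp
        moreover have "L / (128 * d t) * (2 * r t) \<le> real (card (P t)) * (2 * r t)"
          using r0 by (intro mult_right_mono cardP_ge[OF True t]) auto
        moreover have "L / (128 * d t) * (2 * r t) = 1 / 256 * L * v t"
          using rd[OF True] d0[of t] by (simp add: field_simps)
        ultimately show ?thesis by simp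
      qed (simp add: v_def)
      show "measure lborel (A s \<inter> A t) \<le> L * (v s * v t + (1/2) ^ (t - s) * v s)"
        if s: "t0 \<le> s" and st: "s \<le> t" for s t
      proof (cases "N s \<le> 2 ^ s \<and> N t \<le> 2 ^ t")
        case True
        then have Ns: "N s \<le> 2 ^ s" and Nt: "N t \<le> 2 ^ t" by auto
        have t: "t0 \<le> t" using s st by simp
        have "measure lborel (A s \<inter> A t) \<le> real (card (P s)) * ((1 + 4 * r s / d t) * (2 * r t))"
          unfolding A_eq[OF s] A_eq[OF t]
          by (rule measure_nbhd_Int_le[OF finP[OF Ns] finP[OF Nt] sepP[OF Nt] d0 r0 r_decr[OF st]])
        also have "\<dots> \<le> 2 * L / d s * ((1 + 4 * r s / d t) * (2 * r t))"
          using r0 d0[of t] by (intro mult_right_mono cardP_le[OF Ns s]) auto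
        \<comment> \<open>The 1 in the neighbour count yields the first term, which decays
          geometrically relative to block s; the other yields exactly the independent product L * v
          s * v t, as r / d = v / 4.\<close>
        also have "\<dots> = 4 * L / d s * r t + 16 * L * (r s / d s) * (r t / d t)"
          using d0[of s] d0[of t] by (simp add: field_simps)
        also have "\<dots> \<le> 4 * L / d s * ((1/2) ^ (t - s) * r s) + 16 * L * (r s / d s) * (r t / d t)"
          using L d0[of s] by (intro add_right_mono mult_left_mono r_decay[OF st]) auto
        also have "\<dots> = L * (v s * v t + (1/2) ^ (t - s) * v s)"
          using d0[of s] d0[of t] by (simp add: rd[OF Ns] rd[OF Nt] field_simps)
        finally show ?thesis .
      next
        case False
        then have "A s \<inter> A t = {}" using A_empty by blast
        then show ?thesis using L v0 by simp
      qed
    qed (use v0 L in auto)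
    also have "measure lborel (limsup A) \<le> measure lborel (limsup R \<inter> {a<..<b})"
    proof (rule measure_mono_fmeasurable)
      have "A t \<subseteq> R t" "A t \<subseteq> {a<..<b}" for t by (auto simp: A_def R_def P_def nbhd_def)
      then show "limsup A \<subseteq> limsup R \<inter> {a<..<b}"
        by (intro Int_greatest Limsup_mono Limsup_bounded always_eventually allI)
      show "limsup A \<in> sets lborel"
        by (rule measurable_limsup) (auto simp: A_def)
      show "limsup R \<inter> {a<..<b} \<in> fmeasurable lborel"
        by (rule fmeasurableI2[of "{a<..<b}"]) (use ab Rm in \<open>auto simp: fmeasurable_def\<close>)
    qed
    finally show "(1/256)\<^sup>2 / 2 * (b - a) \<le> measure lborel (limsup R \<inter> {a<..<b})"
      by (simp add: L_def)
  qed
  then show ?thesis by (simp add: R_def[abs_def] Q_def r_def)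
qed

text \<open>On [0, 1) the limsup of the grid neighbourhoods lies in \<open>W_D n i j \<psi>\<close>,
  so the main task is to verify the hypotheses of \<open>limsup_nbhd_frac_grid_full\<close> for
  \<open>e t = p t powr j\<close>.\<close>

lemma W_D_conull:
  fixes i j :: real and n :: "nat \<Rightarrow> nat" and \<psi> :: "nat \<Rightarrow> real"
  assumes i: "i > 0" and j: "j > 0" and ij: "i + j = 1"
    and D: "D_adic_sequence n" and bdd: "bounded_ratios n"
    and pos: "\<And>q. 1 \<le> q \<Longrightarrow> 0 < \<psi> q"
    and decr: "\<And>p q. 1 \<le> p \<Longrightarrow> p \<le> q \<Longrightarrow> \<psi> q \<le> \<psi> p"
    and div: "\<not> summable (\<lambda>t. 2 ^ t * \<psi> (2 ^ t))"
  shows "{0..<1} - W_D n i j \<psi> \<in> null_sets lborel"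
proof -
  \<comment> \<open>Truncating \<open>\<psi>\<close> at \<open>1 / q\<close> keeps the series divergent and makes the intervals around the
    points of one grid disjoint.\<close>
  define p where "p t = min (\<psi> (2 ^ t)) (1 / 2 ^ t)" for t :: nat
  obtain C where C: "1 \<le> C" "\<And>k. real (n (Suc k)) / real (n k) \<le> C"
    using bdd unfolding bounded_ratios_def by (metis max.cobounded1 max.coboundedI2)
  have p0: "0 < p t" for t by (simp add: p_def pos)
  have p_le: "p t \<le> 1 / 2 ^ t" for t by (simp add: p_def)
  have p1: "p t \<le> 1" for t
    by (rule order_trans[OF p_le]) simp
  have p_decr: "p t \<le> p s" if "s \<le> t" for s t
  proof -
    have "\<psi> (2 ^ t) \<le> \<psi> (2 ^ s)" using that by (intro decr) auto
    moreover have "1 / 2 ^ t \<le> 1 / (2::real) ^ s" using that by (simp add: field_simps)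
    ultimately show ?thesis unfolding p_def by (rule min.mono)
  qed
  have p_split: "p t powr i * p t powr j = p t" for t
    using p0[of t] ij by (simp flip: powr_add)
  have "\<exists>N. 0 < N \<and> 1 \<le> p t powr i * real N \<and> p t powr i * real N \<le> C \<and>
        (\<forall>q\<ge>1. D_adic_abs n q \<le> p t powr i \<longleftrightarrow> N dvd q)" for t
  proof -
    have "0 < p t powr i" "p t powr i \<le> 1"
      using p0[of t] p1[of t] i by (auto intro: powr_le1)
    then show ?thesis
      using D_adic_abs_le_iff_dvd[OF D, of "p t powr i"] C by metis
  qed
  then obtain N where N: "\<And>t. 0 < N t" and N1: "\<And>t. 1 \<le> p t powr i * real (N t)"
    and NC: "\<And>t. p t powr i * real (N t) \<le> C"
    and ND: "\<And>t q. 1 \<le> q \<Longrightarrow> D_adic_abs n q \<le> p t powr i \<longleftrightarrow> N t dvd q"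
    by metis
  define e where "e t = p t powr j" for t
  have e0: "0 < e t" for t using p0[of t] by (simp add: e_def)
  \<comment> \<open>The truncation p t \<le> 1 / 2 ^ t forces N t to be at least 2 powr (i
    t).\<close>
  have N_inf: "filterlim N at_top sequentially"
  proof -
    have "(2 powr i) ^ t \<le> real (N t)" for t
    proof -
      have "p t powr i \<le> (1 / 2 ^ t) powr i"
        using p_le[of t] p0[of t] i by (intro powr_mono2) auto
      also have "\<dots> = 1 / (2 powr i) ^ t"
        by (simp add: powr_divide powr_realpow powr_powr mult.commute flip: powr_realpow)
      finally have "p t powr i * real (N t) \<le> 1 / (2 powr i) ^ t * real (N t)"
        by (intro mult_right_mono) auto
      then have "1 \<le> 1 / (2 powr i) ^ t * real (N t)" using N1[of t] by linarith
      then show ?thesis by (simp add: field_simps)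
    qed
    moreover have "1 < 2 powr i" using i by simp
    then have "filterlim (\<lambda>t. (2 powr i) ^ t) at_top sequentially"
      by (intro filterlim_at_infinity_imp_filterlim_at_top filterlim_realpow_sequentially_gt1) auto
    ultimately have "filterlim (\<lambda>t. real (N t)) at_top sequentially"
      by (auto intro: filterlim_at_top_mono)
    then show ?thesis by (simp add: filterlim_sequentially_iff_filterlim_real)
  qed
  define v where "v t = (if N t \<le> 2 ^ t then 2 ^ t * e t / real (N t) else 0)" for t
  \<comment> \<open>The ratio left over from \<open>2 ^ t * (C / 2 ^ t) powr (1 / i)\<close>; it is
    below 1 because i < 1.\<close>
  define x where "x = 2 powr (1 - 1 / i)"
  have x: "0 < x" "x < 1"
    using i j ij by (auto simp: x_def powr_less_one)
  \<comment> \<open>Where \<open>N t > 2 ^ t\<close>, bounded ratios force \<open>p t\<close> to be so small that these \<open>t\<close>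
    contribute a convergent geometric series.\<close>
  have bound: "2 ^ t * p t \<le> C * v t + C powr (1 / i) * x ^ t" for t
  proof (cases "N t \<le> 2 ^ t")
    case True
    \<comment> \<open>Splitting off \<open>p t powr i\<close>, which is at most
      \<open>C / N t\<close>, leaves the summand of \<open>v\<close>.\<close>
    have "2 ^ t * p t * real (N t) = 2 ^ t * e t * (p t powr i * real (N t))"
      by (subst p_split[symmetric]) (simp add: e_def)
    also have "\<dots> \<le> 2 ^ t * e t * C"
      using NC e0[of t] by (intro mult_left_mono) auto
    finally have "2 ^ t * p t \<le> C * v t"
      using True N[of t] by (simp add: v_def field_simps)
    moreover have "0 \<le> C powr (1 / i) * x ^ t" using x by simp
    ultimately show ?thesis by linarith
  next
    case False
    then have "2 ^ t \<le> real (N t)"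
      by (metis linorder_le_cases of_nat_le_iff of_nat_numeral of_nat_power)
    then have "p t powr i * 2 ^ t \<le> p t powr i * real (N t)" by (intro mult_left_mono) auto
    then have "p t powr i * 2 ^ t \<le> C" using NC[of t] by linarith
    then have "p t powr i \<le> C / 2 ^ t" by (simp add: field_simps)
    then have "(p t powr i) powr (1 / i) \<le> (C / 2 ^ t) powr (1 / i)"
      using i by (intro powr_mono2) auto
    then have "p t \<le> (C / 2 ^ t) powr (1 / i)" using i p0[of t] by (simp add: powr_powr)
    then have "2 ^ t * p t \<le> 2 ^ t * (C / 2 ^ t) powr (1 / i)" by simp
    also have "\<dots> = C powr (1 / i) * (2 powr real t / 2 powr (real t * (1 / i)))"
      using C(1) by (simp add: powr_divide powr_powr flip: powr_realpow)
    also have "2 powr real t / 2 powr (real t * (1 / i)) = x ^ t"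
      using x(1) by (simp add: x_def powr_powr algebra_simps flip: powr_diff powr_realpow)
    finally show ?thesis using False by (simp add: v_def)
  qed
  have "\<not> summable v"
  proof
    assume "summable v"
    then have "summable (\<lambda>t. C * v t + C powr (1 / i) * x ^ t)"
      using x by (intro summable_add summable_mult summable_geometric) auto
    then have s: "summable (\<lambda>t. 2 ^ t * p t)"
      by (rule summable_comparison_test'[where N = 0]) (use bound p0 in \<open>simp add: less_imp_le\<close>)
    \<comment> \<open>Terms below 1 mean that the truncation is inactive, so convergence for
      \<open>p\<close> would give convergence for \<open>\<psi>\<close>.\<close>
    then have "eventually (\<lambda>t. 2 ^ t * p t < 1) sequentially"
      using order_tendstoD(2)[OF summable_LIMSEQ_zero[OF s], of 1] by simp
    then have "eventually (\<lambda>t. 2 ^ t * p t = 2 ^ t * \<psi> (2 ^ t)) sequentially"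
      by eventually_elim (auto simp: p_def min_def field_simps split: if_splits)
    then have "summable (\<lambda>t. 2 ^ t * \<psi> (2 ^ t))"
      using s by (rule iffD1[OF summable_cong])
    with div show False by simp
  qed
  then have full: "- limsup (\<lambda>t. nbhd (frac_grid (N t) (2 ^ t div N t)) (e t / (4 * 2 ^ t)))
      \<in> null_sets lborel" (is "- limsup ?R \<in> _")
  proof (intro limsup_nbhd_frac_grid_full N N_inf)
    show "0 \<le> e t" for t using e0[of t] by simp
    show "e t \<le> e s" if "s \<le> t" for s t
      unfolding e_def using p_decr[OF that] p0[of t] j by (intro powr_mono2) auto
    \<comment> \<open>Inserting the factor \<open>p t powr i * N t\<close>, which is at least 1,
      turns \<open>e t\<close> into \<open>p t\<close>, and the truncation bounds
      \<open>2 ^ t * p t\<close> by 1.\<close>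
    show "2 ^ t * e t \<le> real (N t)" for t
    proof -
      have "2 ^ t * e t * 1 \<le> 2 ^ t * e t * (p t powr i * real (N t))"
        using N1 e0[of t] by (intro mult_left_mono) auto
      also have "\<dots> = 2 ^ t * (p t powr i * p t powr j) * real (N t)"
        by (simp add: e_def)
      also have "\<dots> \<le> 1 * real (N t)"
        unfolding p_split using p_le[of t] by (intro mult_right_mono) (auto simp: field_simps)
      finally show ?thesis by simp
    qed
  qed (simp add: v_def[abs_def])
  have "{0..<1} - W_D n i j \<psi> \<subseteq> - limsup ?R"
  proof clarify
    fix x assume x: "x \<in> {0..<1::real}" "x \<notin> W_D n i j \<psi>" "x \<in> limsup ?R"
    have "\<exists>q>m. 1 \<le> q \<and> max (D_adic_abs n q powr (1 / i)) (nearest_int_dist (real q * x) powr (1 / j)) \<le> \<psi> q"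
      for m
    proof -
      \<comment> \<open>The denominators of block t are positive multiples of \<open>N t\<close>,
        hence exceed m; this makes infinitely many different q occur.\<close>
      obtain T where T: "\<And>t. T \<le> t \<Longrightarrow> m < N t"
        using N_inf unfolding filterlim_at_top eventually_sequentially by (metis Suc_le_eq)
      obtain t where t: "T \<le> t" "x \<in> ?R t"
        using x(3) unfolding limsup_INF_SUP by auto
      obtain y where "y \<in> frac_grid (N t) (2 ^ t div N t)"
        and y: "\<bar>x - y\<bar> < e t / (4 * 2 ^ t)"
        using t(2) by (auto simp: nbhd_def abs_less_iff)
      then obtain a k where k: "y = of_int a / (real (N t) * real k)" "1 \<le> k" "k \<le> 2 ^ t div N t"
        unfolding frac_grid_def by blast
      define q where "q = N t * k"
      have "N t \<le> q" using k(2) by (simp add: q_def)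
      then have mq: "m < q" and q1: "1 \<le> q" using T[OF t(1)] N[of t] by auto
      have q2: "q \<le> 2 ^ t"
        using k(3) N[of t] by (simp add: q_def less_eq_div_iff_mult_less_eq mult.commute)
      \<comment> \<open>The grid uses denominators up to \<open>2 ^ t\<close>, not beyond, so that
        the block value bounds \<open>\<psi> q\<close> from below.\<close>
      have pq: "p t \<le> \<psi> q"
        using decr[OF q1 q2] by (simp add: p_def)
      have "D_adic_abs n q \<le> p t powr i" using ND[OF q1] by (simp add: q_def)
      moreover have "0 \<le> D_adic_abs n q"
        using D_adic_abs_attained[OF D q1] by (metis of_nat_0_le_iff zero_le_divide_1_iff)
      ultimately have "D_adic_abs n q powr (1 / i) \<le> p t"
        using powr_inverse_le_iff[of i "D_adic_abs n q" "p t"] i p0[of t] by simp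
      moreover have "nearest_int_dist (real q * x) \<le> e t"
        unfolding nearest_int_dist_def
      proof (rule infdist_le2)
        have yq: "y = of_int a / real q" using k(1) by (simp add: q_def)
        then have "dist (real q * x) (of_int a) = real q * \<bar>x - y\<bar>"
          using q1 by (simp add: dist_real_def abs_mult_pos' right_diff_distrib flip: abs_mult_pos)
        also have "\<dots> \<le> 2 ^ t * (e t / (4 * 2 ^ t))"
        proof (rule mult_mono)
          show "real q \<le> 2 ^ t" using q2 by (metis of_nat_le_iff of_nat_numeral of_nat_power)
        qed (use y in auto)
        also have "\<dots> \<le> e t" using e0[of t] by simp
        finally show "dist (real q * x) (of_int a) \<le> e t" .
      qed auto
      then have "nearest_int_dist (real q * x) powr (1 / j) \<le> p t"
        using powr_inverse_le_iff[of j "nearest_int_dist (real q * x)" "p t"] j p0[of t]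
        by (simp add: e_def nearest_int_dist_def infdist_nonneg)
      ultimately show ?thesis using mq q1 pq by (intro exI[of _ q]) auto
    qed
    then have "x \<in> W_D n i j \<psi>"
      using x(1) unfolding W_D_def infinite_nat_iff_unbounded by auto
    with x(2) show False by simp
  qed
  then show ?thesis
    using W_D_measurable[of n i j \<psi>] by (intro null_sets_subset[OF full]) auto
qed

section \<open>Cauchy condensation and the two alternatives\<close>

theorem theorem1:
  fixes i j :: real and n :: "nat \<Rightarrow> nat" and \<psi> :: "nat \<Rightarrow> real"
  assumes "i > 0" and "j > 0" and "i + j = 1"
    and "D_adic_sequence n" and "bounded_ratios n"
    and "\<And>q. 1 \<le> q \<Longrightarrow> 0 \<le> \<psi> q"
    and "\<And>p q. 1 \<le> p \<Longrightarrow> p \<le> q \<Longrightarrow> \<psi> q \<le> \<psi> p"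
    and "\<psi> \<longlonglongrightarrow> 0"
  shows "emeasure lebesgue (W_D n i j \<psi>) = (if summable (\<lambda>r. \<psi> (Suc r)) then 0 else 1)"
proof -
  have W [measurable]: "W_D n i j \<psi> \<in> sets lborel"
    using W_D_measurable by simp
  then have leb: "emeasure lebesgue (W_D n i j \<psi>) = emeasure lborel (W_D n i j \<psi>)"
    by simp
  \<comment> \<open>Nothing is assumed about \<open>\<psi> 0\<close>, so it is replaced by 0 before
    condensation.\<close>
  define f where "f q = (if q = 0 then 0 else \<psi> q)" for q
  have "summable (\<lambda>r. \<psi> (Suc r)) \<longleftrightarrow> summable f"
    using summable_Suc_iff[of f] by (simp add: f_def)
  also have "\<dots> \<longleftrightarrow> summable (\<lambda>t. 2 ^ t * f (2 ^ t))"
    by (rule condensation_test) (use assms(6,7) in \<open>auto simp: f_def\<close>)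
  finally have cond: "summable (\<lambda>r. \<psi> (Suc r)) \<longleftrightarrow> summable (\<lambda>t. 2 ^ t * \<psi> (2 ^ t))"
    by (simp add: f_def)
  show ?thesis
  proof (cases "summable (\<lambda>r. \<psi> (Suc r))")
    case True
    then have "W_D n i j \<psi> \<in> null_sets lborel"
      using cond assms by (intro W_D_null) auto
    then show ?thesis using True leb by auto
  next
    case False
    \<comment> \<open>Once a decreasing nonnegative function vanishes it stays 0, and the series
      would be a finite sum.\<close>
    have pos: "0 < \<psi> q" if "1 \<le> q" for q
    proof (rule ccontr)
      assume "\<not> 0 < \<psi> q"
      then have "\<psi> r = 0" if "q \<le> r" for r
        using assms(6)[of r] assms(7)[of q r] \<open>1 \<le> q\<close> that by simp
      then have "summable (\<lambda>r. \<psi> (Suc r))"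
        by (intro summable_finite[of "{..<q}"]) auto
      with False show False by simp
    qed
    have null: "{0..<1} - W_D n i j \<psi> \<in> null_sets lborel"
      using False cond pos assms by (intro W_D_conull) auto
    have "W_D n i j \<psi> = {0..<1} - ({0..<1} - W_D n i j \<psi>)"
      by (auto simp: W_D_def)
    then have "emeasure lborel (W_D n i j \<psi>) = emeasure lborel ({0..<1} - ({0..<1} - W_D n i j \<psi>))"
      by simp
    also have "\<dots> = emeasure lborel {0..<1::real}"
      using null by (intro emeasure_Diff_null_set) auto
    finally show ?thesis using False leb by simp
  qed
qed

end
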